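(* Let $R,S,I_1,I_2$ be mutually independent random variables, where $R$ is almost surely positive with distribution function $F$, $S$ takes values in $(0,1)$ and has a distribution function $G$ possessing a continuous density function $g$, and $I_1,I_2$ take the values $-1,1$ with probability $1/2$ each. Let $(U_1,U_2)$ be a random vector with $(U_1,U_2)\overset{d}{=}R\,(I_1S,\,I_2\sqrt{1-S^2})$, and for $\rho\in(0,1)$ let $U(\rho)=\rho U_1+\sqrt{1-\rho^2}\,U_2$. If $F\in\mathrm{MDA}(\Psi_\gamma)$ with $\gamma\in(0,\infty)$ and $r_F=1$, then $$\mathbf P\{U(\rho)>u\}\sim\mathbf P\{U_1>u\},\qquad u\uparrow r_F,$$ holds for all $\rho\in(0,1)$ if and only if $(U_1,U_2)$ is spherical.
   Context: $\overline F=1-F$, $r_F=\sup\{x:F(x)<1\}$; $a(u)\sim b(u)$ means $a(u)/b(u)\to1$ in the indicated limit; $\overset{d}{=}$ is equality in distribution. $(U_1,U_2)$ is called spherical if it is a spherically distributed random vector, i.e. its distribution is invariant under orthogonal transformations of $\mathbb R^2$. The density $g$ is continuous on $(0,1)$. $F\in\mathrm{MDA}(\Psi_\gamma)$ (Weibull max-domain of attraction) with $r_F=1$ means $\lim_{u\to\infty}\overline F(1-x/u)/\overline F(1-1/u)=x^\gamma$ for all $x>0$. *)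

theory Defs
  imports "HOL-Probability.Probability"
begin

text \<open>
  The right endpoint is taken in the extended reals, so that it is meaningful for every
  distribution function; on \<^typ>\<open>real\<close>, \<^const>\<open>Sup\<close> of an unbounded set is unspecified.
\<close>

definition right_endpoint :: "(real \<Rightarrow> real) \<Rightarrow> ereal" where
  "right_endpoint F = (SUP x\<in>{x. F x < 1}. ereal x)"

text \<open>
  Membership in the max-domain of attraction of the Weibull law \<open>\<Psi>\<^sub>\<gamma>\<close>, in terms of the
  survival function \<open>1 - F\<close> at the (necessarily finite) right endpoint \<open>r\<close>.
\<close>

definition weibull_mda :: "real \<Rightarrow> (real \<Rightarrow> real) \<Rightarrow> bool" where
  "weibull_mda \<gamma> F \<longleftrightarrow>
     (\<exists>r::real. right_endpoint F = ereal r \<and>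
        (\<forall>x>0. ((\<lambda>u. (1 - F (r - x / u)) / (1 - F (r - 1 / u))) \<longlongrightarrow> x powr \<gamma>) at_top))"

definition spherical :: "'b measure \<Rightarrow> ('b \<Rightarrow> real \<times> real) \<Rightarrow> bool" where
  "spherical N U \<longleftrightarrow>
     (\<forall>T. orthogonal_transformation T \<longrightarrow>
        distr N borel (\<lambda>\<omega>. T (U \<omega>)) = distr N borel U)"

end

theory Submission
  imports Defs
begin

text \<open>
  The vector \<open>(I\<^sub>1 S, I\<^sub>2 \<surd>(1 - S\<^sup>2))\<close> is a random point of the unit circle, so
  \<open>(U\<^sub>1, U\<^sub>2)\<close> is a random direction stretched by an independent radius. Write the direction as
  \<open>(sin \<theta>, cos \<theta>)\<close> with \<open>\<theta>\<close> in \<open>[-\<pi>, \<pi>]\<close>. Substituting \<open>s = sin \<theta>\<close> shows that \<open>\<theta>\<close> has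
  density \<open>H(\<theta>)/4\<close>, where \<open>H(\<theta>) = g(\<bar>sin \<theta>\<bar>) \<bar>cos \<theta>\<bar>\<close>; this is lemma \<open>polar_probability\<close>.

  If \<open>\<rho> = sin \<alpha>\<close>, then \<open>U(\<rho>) = R cos(\<theta> - \<alpha>)\<close>, hence
  \<open>P(U(\<rho>) > u) = \<integral> H(\<theta>)/4 P(R cos(\<theta> - \<alpha>) > u) d\<theta>\<close>.
  As the radius does not exceed 1, for \<open>u\<close> near 1 only angles close to \<open>\<alpha>\<close> contribute, and \<open>H\<close> is
  continuous at \<open>\<alpha>\<close>. Therefore \<open>P(U(\<rho>) > u) / K(u)\<close> tends to \<open>H(\<alpha>)/4\<close>, where
  \<open>K(u) = \<integral> P(R cos t > u) dt\<close> is positive and does not depend on \<open>\<rho>\<close>; this is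
  lemma \<open>angular_tail_asymptotics\<close>.

  If all the tails \<open>P(U(\<rho>) > u)\<close> are equivalent to the tail of \<open>U\<^sub>1\<close>, they are equivalent to each other,
  so \<open>H\<close> takes one value \<open>c\<close> on \<open>(0, \<pi>/2)\<close>, and by symmetry almost everywhere. The direction is then
  uniform on the circle. Since an orthogonal map of the plane acts on angles as \<open>\<theta> \<mapsto> a \<plusminus> \<theta>\<close> and leaves
  the radius alone, uniformity gives sphericity (\<open>nn_integral_circle_orthogonal\<close>). Comparing the \<open>U(\<rho>)\<close>
  among themselves is what makes this work: the tail of \<open>U\<^sub>1\<close> itself depends on \<open>g\<close> near 1, where
  nothing is known about \<open>g\<close>.

  Conversely, if \<open>(U\<^sub>1, U\<^sub>2)\<close> is spherical, a reflection carries \<open>U(\<rho>)\<close> to \<open>U\<^sub>1\<close>, so the two tails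
  are equal. The quotient is then 1 as soon as the common tail is positive, which the asymptotics
  give at any \<open>\<rho>\<close> with \<open>g(\<rho>) > 0\<close>.
\<close>

section \<open>Integration over the circle\<close>

lemma nn_integral_Icc_split:
  fixes f :: "real \<Rightarrow> ennreal"
  assumes [measurable]: "f \<in> borel_measurable borel" and "a \<le> b" "b \<le> c"
  shows "(\<integral>\<^sup>+x\<in>{a..c}. f x \<partial>lborel) = (\<integral>\<^sup>+x\<in>{a..b}. f x \<partial>lborel) + (\<integral>\<^sup>+x\<in>{b..c}. f x \<partial>lborel)"
proof -
  have "(\<integral>\<^sup>+x\<in>{a..c}. f x \<partial>lborel)
      = (\<integral>\<^sup>+x. f x * indicator {a..b} x + f x * indicator {b..c} x \<partial>lborel)"
    using AE_lborel_singleton[of b] assms(2,3)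
    by (intro nn_integral_cong_AE) (auto elim!: eventually_mono split: split_indicator)
  then show ?thesis by (simp add: nn_integral_add)
qed

lemma nn_integral_Icc_shift:
  fixes f :: "real \<Rightarrow> ennreal"
  assumes [measurable]: "f \<in> borel_measurable borel"
  shows "(\<integral>\<^sup>+x\<in>{a..b}. f (x + t) \<partial>lborel) = (\<integral>\<^sup>+x\<in>{a + t..b + t}. f x \<partial>lborel)"
  by (subst (2) nn_integral_real_affine[where c=1 and t=t])
     (auto intro!: nn_integral_cong simp: add.commute split: split_indicator)

lemma nn_integral_Icc_reflect:
  fixes f :: "real \<Rightarrow> ennreal"
  assumes [measurable]: "f \<in> borel_measurable borel"
  shows "(\<integral>\<^sup>+x\<in>{a..b}. f (t - x) \<partial>lborel) = (\<integral>\<^sup>+x\<in>{t - b..t - a}. f x \<partial>lborel)"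
  by (subst (2) nn_integral_real_affine[where c="-1" and t=t])
     (auto intro!: nn_integral_cong split: split_indicator)

text \<open>
  The four sign patterns of a point \<open>(\<plusminus> sin \<theta>, \<plusminus> cos \<theta>)\<close> with \<open>\<theta>\<close> in the first quadrant sweep the
  four quadrants, so two independent signs and an acute angle amount to one angle on the full circle.
\<close>

lemma nn_integral_quadrants:
  fixes \<phi> :: "real \<times> real \<Rightarrow> ennreal"
  assumes [measurable]: "\<phi> \<in> borel_measurable borel"
  shows "(\<integral>\<^sup>+\<theta>\<in>{-pi..pi}. \<phi> (sin \<theta>, cos \<theta>) \<partial>lborel) =
    (\<integral>\<^sup>+\<theta>\<in>{0..pi/2}. \<phi> (sin \<theta>, cos \<theta>) \<partial>lborel) + (\<integral>\<^sup>+\<theta>\<in>{0..pi/2}. \<phi> (sin \<theta>, - cos \<theta>) \<partial>lborel)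
  + (\<integral>\<^sup>+\<theta>\<in>{0..pi/2}. \<phi> (- sin \<theta>, cos \<theta>) \<partial>lborel) + (\<integral>\<^sup>+\<theta>\<in>{0..pi/2}. \<phi> (- sin \<theta>, - cos \<theta>) \<partial>lborel)"
proof -
  let ?f = "\<lambda>\<theta>. \<phi> (sin \<theta>, cos \<theta>)"
  have [measurable]: "?f \<in> borel_measurable borel"
    unfolding borel_prod[symmetric] by measurable
  have "-(pi/2) \<le> pi" using pi_ge_zero by linarith
  then have "(\<integral>\<^sup>+\<theta>\<in>{-pi..pi}. ?f \<theta> \<partial>lborel) =
      (\<integral>\<^sup>+\<theta>\<in>{-pi..-(pi/2)}. ?f \<theta> \<partial>lborel) + (\<integral>\<^sup>+\<theta>\<in>{-(pi/2)..0}. ?f \<theta> \<partial>lborel)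
    + (\<integral>\<^sup>+\<theta>\<in>{0..pi/2}. ?f \<theta> \<partial>lborel) + (\<integral>\<^sup>+\<theta>\<in>{pi/2..pi}. ?f \<theta> \<partial>lborel)"
    using nn_integral_Icc_split[of ?f "-pi" "-(pi/2)" pi] nn_integral_Icc_split[of ?f "-(pi/2)" 0 pi]
      nn_integral_Icc_split[of ?f 0 "pi/2" pi] by (simp add: add.assoc)
  moreover have "(\<integral>\<^sup>+\<theta>\<in>{0..pi/2}. \<phi> (- sin \<theta>, - cos \<theta>) \<partial>lborel) = (\<integral>\<^sup>+\<theta>\<in>{-pi..-(pi/2)}. ?f \<theta> \<partial>lborel)"
    using nn_integral_Icc_shift[where f="?f" and a=0 and b="pi/2" and t="-pi"] by (simp add: sin_diff cos_diff)
  moreover have "(\<integral>\<^sup>+\<theta>\<in>{0..pi/2}. \<phi> (- sin \<theta>, cos \<theta>) \<partial>lborel) = (\<integral>\<^sup>+\<theta>\<in>{-(pi/2)..0}. ?f \<theta> \<partial>lborel)"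
    using nn_integral_Icc_reflect[where f="?f" and a=0 and b="pi/2" and t=0] by simp
  moreover have "(\<integral>\<^sup>+\<theta>\<in>{0..pi/2}. \<phi> (sin \<theta>, - cos \<theta>) \<partial>lborel) = (\<integral>\<^sup>+\<theta>\<in>{pi/2..pi}. ?f \<theta> \<partial>lborel)"
    using nn_integral_Icc_reflect[where f="?f" and a=0 and b="pi/2" and t=pi] by (simp add: sin_diff cos_diff)
  ultimately show ?thesis by (simp add: ac_simps)
qed

lemma nn_integral_period_shift:
  fixes f :: "real \<Rightarrow> ennreal"
  assumes [measurable]: "f \<in> borel_measurable borel" and per: "\<And>x. f (x + 2 * pi) = f x"
    and a: "0 \<le> a" "a < 2 * pi"
  shows "(\<integral>\<^sup>+x\<in>{-pi..pi}. f (x + a) \<partial>lborel) = (\<integral>\<^sup>+x\<in>{-pi..pi}. f x \<partial>lborel)"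
proof -
  have "(\<integral>\<^sup>+x\<in>{-pi..pi}. f (x + a) \<partial>lborel) = (\<integral>\<^sup>+x\<in>{-pi+a..pi+a}. f x \<partial>lborel)"
    by (rule nn_integral_Icc_shift) simp
  also have "\<dots> = (\<integral>\<^sup>+x\<in>{-pi+a..pi}. f x \<partial>lborel) + (\<integral>\<^sup>+x\<in>{pi..pi+a}. f x \<partial>lborel)"
    using a by (intro nn_integral_Icc_split) auto
  also have "(\<integral>\<^sup>+x\<in>{pi..pi+a}. f x \<partial>lborel) = (\<integral>\<^sup>+x\<in>{-pi..-pi+a}. f x \<partial>lborel)"
  proof -
    have "-pi + 2*pi = pi" "-pi + a + 2*pi = pi + a" by simp_all
    then show ?thesis using nn_integral_Icc_shift[where f=f and a="-pi" and b="-pi+a" and t="2*pi"] unfolding per by simp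
  qed
  also have "(\<integral>\<^sup>+x\<in>{-pi+a..pi}. f x \<partial>lborel) + (\<integral>\<^sup>+x\<in>{-pi..-pi+a}. f x \<partial>lborel) = (\<integral>\<^sup>+x\<in>{-pi..pi}. f x \<partial>lborel)"
    using a nn_integral_Icc_split[of f "-pi" "-pi+a" pi] by (simp add: add.commute)
  finally show ?thesis .
qed

text \<open>
  The images of the two unit vectors are again orthonormal. The image of \<open>(0, 1)\<close> fixes the angle \<open>a\<close>, and
  the image of \<open>(1, 0)\<close> is then one of the two unit vectors orthogonal to it; \<open>\<epsilon>\<close>, the determinant, tells which one.
\<close>

lemma orthogonal_transformation_plane:
  fixes T :: "real \<times> real \<Rightarrow> real \<times> real"
  assumes T: "orthogonal_transformation T"
  obtains a \<epsilon> where "0 \<le> a" "a < 2 * pi" "\<epsilon> = 1 \<or> \<epsilon> = (-1::real)"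
    "\<And>\<theta>. T (sin \<theta>, cos \<theta>) = (sin (a + \<epsilon> * \<theta>), cos (a + \<epsilon> * \<theta>))"
proof -
  obtain p q where pq: "T (1, 0) = (p, q)" by fastforce
  obtain x y where xy: "T (0, 1) = (x, y)" by fastforce
  have inner: "T v \<bullet> T w = v \<bullet> w" for v w
    using T unfolding orthogonal_transformation_def by blast
  have lin: "linear T" using T by (simp add: orthogonal_transformation_linear)
  have n1: "p\<^sup>2 + q\<^sup>2 = 1" using inner[of "(1,0)" "(1,0)"] by (simp add: pq power2_eq_square)
  have n2: "x\<^sup>2 + y\<^sup>2 = 1" using inner[of "(0,1)" "(0,1)"] by (simp add: xy power2_eq_square)
  have n3: "p * x + q * y = 0" using inner[of "(1,0)" "(0,1)"] by (simp add: pq xy)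
  obtain a where a: "0 \<le> a" "a < 2 * pi" "y = cos a" "x = sin a"
    using sincos_total_2pi[of y x] n2 by (metis add.commute)
  have d: "(p * y - q * x)\<^sup>2 = 1"
  proof -
    have "(p * y - q * x)\<^sup>2 + (p * x + q * y)\<^sup>2 = (p\<^sup>2 + q\<^sup>2) * (x\<^sup>2 + y\<^sup>2)" by algebra
    then show ?thesis using n1 n2 n3 by simp
  qed
  define \<epsilon> where "\<epsilon> = p * y - q * x"
  have e: "\<epsilon> = 1 \<or> \<epsilon> = -1" using d by (simp add: \<epsilon>_def power2_eq_1_iff)
  have "p = \<epsilon> * y" "q = - (\<epsilon> * x)"
  proof -
    have "\<epsilon> * y = p * (x\<^sup>2 + y\<^sup>2) - x * (p * x + q * y)" unfolding \<epsilon>_def by algebra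
    then show "p = \<epsilon> * y" using n2 n3 by simp
    have "\<epsilon> * x = y * (p * x + q * y) - q * (x\<^sup>2 + y\<^sup>2)" unfolding \<epsilon>_def by algebra
    then show "q = - (\<epsilon> * x)" using n2 n3 by simp
  qed
  then have "T (sin \<theta>, cos \<theta>) = (sin (a + \<epsilon> * \<theta>), cos (a + \<epsilon> * \<theta>))" for \<theta>
  proof -
    have "T (sin \<theta>, cos \<theta>) = T (sin \<theta> *\<^sub>R (1, 0) + cos \<theta> *\<^sub>R (0, 1))" by simp
    also have "\<dots> = sin \<theta> *\<^sub>R (p, q) + cos \<theta> *\<^sub>R (x, y)"
      by (simp only: linear_add[OF lin] linear_scale[OF lin] pq xy)
    finally show ?thesis using e \<open>p = \<epsilon> * y\<close> \<open>q = - (\<epsilon> * x)\<close> a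
      by (auto simp: sin_add cos_add sin_diff cos_diff algebra_simps)
  qed
  with a e that show thesis by blast
qed

text \<open>
  Rotation invariance of arc length: on angles, an orthogonal map is a shift, possibly after a reflection,
  and the integrand is \<open>2\<pi>\<close>-periodic.
\<close>

lemma nn_integral_circle_orthogonal:
  fixes \<phi> :: "real \<times> real \<Rightarrow> ennreal"
  assumes [measurable]: "\<phi> \<in> borel_measurable borel" and T: "orthogonal_transformation T"
  shows "(\<integral>\<^sup>+\<theta>\<in>{-pi..pi}. \<phi> (T (sin \<theta>, cos \<theta>)) \<partial>lborel) = (\<integral>\<^sup>+\<theta>\<in>{-pi..pi}. \<phi> (sin \<theta>, cos \<theta>) \<partial>lborel)"
proof -
  obtain a \<epsilon> where a: "0 \<le> a" "a < 2 * pi" and \<epsilon>: "\<epsilon> = 1 \<or> \<epsilon> = (-1::real)"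
    and T: "\<And>\<theta>. T (sin \<theta>, cos \<theta>) = (sin (a + \<epsilon> * \<theta>), cos (a + \<epsilon> * \<theta>))"
    by (rule orthogonal_transformation_plane[OF T]) blast
  let ?f = "\<lambda>\<theta>. \<phi> (sin \<theta>, cos \<theta>)"
  have [measurable]: "?f \<in> borel_measurable borel"
    unfolding borel_prod[symmetric] by measurable
  have shift: "(\<integral>\<^sup>+\<theta>\<in>{-pi..pi}. ?f (\<theta> + a) \<partial>lborel) = (\<integral>\<^sup>+\<theta>\<in>{-pi..pi}. ?f \<theta> \<partial>lborel)"
    using a by (intro nn_integral_period_shift) simp_all
  from \<epsilon> show ?thesis
  proof
    assume "\<epsilon> = 1"
    then show ?thesis using shift by (simp add: T add.commute)
  next
    assume "\<epsilon> = -1"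
    then show ?thesis
      using shift nn_integral_Icc_reflect[where f="\<lambda>\<theta>. ?f (\<theta> + a)" and a="-pi" and b=pi and t=0]
      by (simp add: T)
  qed
qed

text \<open>
  The range \<open>3\<pi>/2\<close> is needed because \<open>\<theta> - \<alpha>\<close> runs that far when \<open>\<theta>\<close> lies in \<open>[-\<pi>, \<pi>]\<close> and
  \<open>\<alpha>\<close> is acute.
\<close>

lemma cos_le_cos_of_abs_ge:
  assumes "0 \<le> \<delta>" "\<delta> \<le> pi / 2" "\<delta> \<le> \<bar>t\<bar>" "\<bar>t\<bar> \<le> 3 * pi / 2"
  shows "cos t \<le> cos \<delta>"
proof (cases "\<bar>t\<bar> \<le> pi")
  case True
  then show ?thesis using assms cos_monotone_0_pi_le[of \<delta> "\<bar>t\<bar>"] by simp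
next
  case False
  have "cos t = - cos (\<bar>t\<bar> - pi)" by (simp add: cos_diff)
  also have "\<dots> \<le> 0"
  proof -
    have "0 \<le> cos (\<bar>t\<bar> - pi)" using False assms by (intro cos_ge_zero) auto
    then show ?thesis by linarith
  qed
  also have "0 \<le> cos \<delta>" using assms by (simp add: cos_ge_zero)
  finally show ?thesis .
qed

section \<open>Polar decomposition of the distribution\<close>

context prob_space
begin

text \<open>
  Independence makes it possible to integrate over two copies of the sample point instead of one.
\<close>

lemma nn_integral_indep_var:
  assumes ind: "indep_var A X B Y" and f[measurable]: "f \<in> borel_measurable (A \<Otimes>\<^sub>M B)"
  shows "(\<integral>\<^sup>+\<omega>. f (X \<omega>, Y \<omega>) \<partial>M) = (\<integral>\<^sup>+\<omega>. \<integral>\<^sup>+\<omega>'. f (X \<omega>, Y \<omega>') \<partial>M \<partial>M)"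
proof -
  have X[measurable]: "X \<in> measurable M A" and Y[measurable]: "Y \<in> measurable M B"
    and eq: "distr M A X \<Otimes>\<^sub>M distr M B Y = distr M (A \<Otimes>\<^sub>M B) (\<lambda>x. (X x, Y x))"
    using ind unfolding indep_var_distribution_eq by auto
  interpret B: prob_space "distr M B Y" by (rule prob_space_distr) simp
  have "(\<integral>\<^sup>+\<omega>. f (X \<omega>, Y \<omega>) \<partial>M) = (\<integral>\<^sup>+z. f z \<partial>(distr M A X \<Otimes>\<^sub>M distr M B Y))"
    by (simp add: eq nn_integral_distr)
  also have "\<dots> = (\<integral>\<^sup>+x. \<integral>\<^sup>+y. f (x, y) \<partial>distr M B Y \<partial>distr M A X)"
    by (rule B.nn_integral_fst[symmetric]) simp
  also have "\<dots> = (\<integral>\<^sup>+\<omega>. \<integral>\<^sup>+y. f (X \<omega>, y) \<partial>distr M B Y \<partial>M)"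
    by (rule nn_integral_distr) measurable
  also have "\<dots> = (\<integral>\<^sup>+\<omega>. \<integral>\<^sup>+\<omega>'. f (X \<omega>, Y \<omega>') \<partial>M \<partial>M)"
    by (intro nn_integral_cong nn_integral_distr) (auto dest: measurable_space[OF X])
  finally show ?thesis .
qed

lemma nn_integral_fair_sign:
  fixes I :: "'a \<Rightarrow> real"
  assumes [measurable]: "random_variable borel I" "k \<in> borel_measurable borel"
    and I: "prob {\<omega>\<in>space M. I \<omega> = 1} = 1/2" "prob {\<omega>\<in>space M. I \<omega> = -1} = 1/2"
  shows "(\<integral>\<^sup>+\<omega>. k (I \<omega>) \<partial>M) = ennreal (1/2) * (k 1 + k (-1))"
proof -
  have "prob ({\<omega>\<in>space M. I \<omega> = 1} \<union> {\<omega>\<in>space M. I \<omega> = -1}) = 1"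
    by (subst finite_measure_Union) (auto simp: I)
  then have "AE \<omega> in M. \<omega> \<in> {\<omega>\<in>space M. I \<omega> = 1} \<union> {\<omega>\<in>space M. I \<omega> = -1}"
    by (subst AE_in_set_eq_1) auto
  then have "(\<integral>\<^sup>+\<omega>. k (I \<omega>) \<partial>M) = (\<integral>\<^sup>+\<omega>. k 1 * indicator {\<omega>\<in>space M. I \<omega> = 1} \<omega>
      + k (-1) * indicator {\<omega>\<in>space M. I \<omega> = -1} \<omega> \<partial>M)"
    by (intro nn_integral_cong_AE) (auto elim!: eventually_mono split: split_indicator)
  also have "\<dots> = k 1 * ennreal (1/2) + k (-1) * ennreal (1/2)"
    by (simp add: nn_integral_add nn_integral_cmult emeasure_eq_measure I)
  finally show ?thesis by (simp add: distrib_left mult.commute)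
qed

text \<open>
  Passing from the density \<open>W\<close> of \<open>S\<close> to the density \<open>W (sin \<theta>) cos \<theta>\<close> of the angle \<open>arcsin S\<close>.
\<close>

lemma nn_integral_arcsin_substitution:
  fixes S :: "'a \<Rightarrow> real" and W k :: "real \<Rightarrow> real"
  assumes S: "distributed M lborel S (\<lambda>s. ennreal (W s))"
    and W[measurable]: "W \<in> borel_measurable borel" and W0: "\<And>s. W s \<ge> 0" "\<And>s. s \<notin> {0..1} \<Longrightarrow> W s = 0"
    and k[measurable]: "k \<in> borel_measurable borel" and k0: "\<And>s. k s \<ge> 0"
  shows "(\<integral>\<^sup>+\<omega>. ennreal (k (S \<omega>)) \<partial>M) = (\<integral>\<^sup>+\<theta>\<in>{0..pi/2}. ennreal (W (sin \<theta>) * cos \<theta> * k (sin \<theta>)) \<partial>lborel)"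
proof -
  have "(\<integral>\<^sup>+\<omega>. ennreal (k (S \<omega>)) \<partial>M) = (\<integral>\<^sup>+s. ennreal (W s) * ennreal (k s) \<partial>lborel)"
    by (rule distributed_nn_integral[OF S, symmetric]) simp
  also have "\<dots> = (\<integral>\<^sup>+s. ennreal (W s * k s) * indicator {sin 0..sin (pi/2)} s \<partial>lborel)"
    using W0 k0 by (intro nn_integral_cong) (auto simp: ennreal_mult split: split_indicator)
  also have "\<dots> = (\<integral>\<^sup>+\<theta>. ennreal (W (sin \<theta>) * k (sin \<theta>) * cos \<theta> * indicator {0..pi/2} \<theta>) \<partial>lborel)"
    unfolding nn_integral_set_ennreal
    by (rule nn_integral_substitution)
       (auto intro!: derivative_eq_intros continuous_intros cos_ge_zero simp: set_borel_measurable_def)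
  also have "\<dots> = (\<integral>\<^sup>+\<theta>\<in>{0..pi/2}. ennreal (W (sin \<theta>) * cos \<theta> * k (sin \<theta>)) \<partial>lborel)"
    by (intro nn_integral_cong) (auto simp: ac_simps split: split_indicator)
  finally show ?thesis .
qed

lemma nn_integral_indicator_scaleR:
  fixes R :: "'a \<Rightarrow> real" and v :: "real \<times> real"
  assumes [measurable]: "random_variable borel R" "A \<in> sets borel"
  shows "(\<integral>\<^sup>+\<omega>. indicator A (R \<omega> *\<^sub>R v) \<partial>M) = ennreal (prob {\<omega>\<in>space M. R \<omega> *\<^sub>R v \<in> A})"
proof -
  have "(\<integral>\<^sup>+\<omega>. indicator A (R \<omega> *\<^sub>R v) \<partial>M) = (\<integral>\<^sup>+\<omega>. indicator {\<omega>\<in>space M. R \<omega> *\<^sub>R v \<in> A} \<omega> \<partial>M)"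
    by (intro nn_integral_cong) (auto split: split_indicator)
  then show ?thesis by (simp add: emeasure_eq_measure)
qed

lemma scaleR_prob_measurable:
  fixes R :: "'a \<Rightarrow> real" and A :: "(real \<times> real) set"
  assumes [measurable]: "random_variable borel R" "A \<in> sets borel"
  shows "(\<lambda>v. prob {\<omega>\<in>space M. R \<omega> *\<^sub>R v \<in> A}) \<in> borel_measurable borel"
proof -
  have "(\<lambda>v. enn2real (\<integral>\<^sup>+\<omega>. indicator A (R \<omega> *\<^sub>R v) \<partial>M)) \<in> borel_measurable borel" by measurable
  then show ?thesis by (simp only: nn_integral_indicator_scaleR[OF assms] enn2real_ennreal[OF measure_nonneg])
qed

text \<open>
  The polar decomposition. Conditioning on the signs and on \<open>S\<close> leaves the radius, whose contribution in
  direction \<open>v\<close> is \<open>prob {R v \<in> A}\<close>; averaging over the signs yields one integral over an acute angle for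
  each quadrant, and these four combine to an integral over the circle.
\<close>

lemma polar_probability:
  fixes R S I J :: "'a \<Rightarrow> real" and W :: "real \<Rightarrow> real" and A :: "(real \<times> real) set"
  assumes indep: "indep_vars (\<lambda>_. borel) (\<lambda>i. [R, S, I, J] ! i) {..<4}"
    and S: "distributed M lborel S (\<lambda>s. ennreal (W s))"
    and W[measurable]: "W \<in> borel_measurable borel" and W0: "\<And>s. W s \<ge> 0" "\<And>s. s \<notin> {0..1} \<Longrightarrow> W s = 0"
    and I: "prob {\<omega>\<in>space M. I \<omega> = 1} = 1/2" "prob {\<omega>\<in>space M. I \<omega> = -1} = 1/2"
    and J: "prob {\<omega>\<in>space M. J \<omega> = 1} = 1/2" "prob {\<omega>\<in>space M. J \<omega> = -1} = 1/2"
    and A[measurable]: "A \<in> sets borel"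
  shows "emeasure M {\<omega>\<in>space M. R \<omega> *\<^sub>R (I \<omega> * S \<omega>, J \<omega> * sqrt (1 - (S \<omega>)\<^sup>2)) \<in> A} =
    ennreal (1/4) * (\<integral>\<^sup>+\<theta>\<in>{-pi..pi}. ennreal (W \<bar>sin \<theta>\<bar> * \<bar>cos \<theta>\<bar> *
        prob {\<omega>\<in>space M. R \<omega> *\<^sub>R (sin \<theta>, cos \<theta>) \<in> A}) \<partial>lborel)"
proof -
  have rv: "random_variable borel ([R, S, I, J] ! i)" if "i < 4" for i
    using indep that unfolding indep_vars_def by auto
  have Rm[measurable]: "random_variable borel R" and Sm[measurable]: "random_variable borel S"
    and Im[measurable]: "random_variable borel I" and Jm[measurable]: "random_variable borel J"
    using rv[of 0] rv[of 1] rv[of 2] rv[of 3] by simp_all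
  have pair: "indep_var borel ([R, S, I, J] ! i) borel ([R, S, I, J] ! j)" if "i < 4" "j < 4" "i \<noteq> j" for i j
  proof -
    have "indep_var borel ((\<lambda>f. f i) \<circ> (\<lambda>\<omega>. restrict (\<lambda>i. ([R, S, I, J] ! i) \<omega>) {i}))
        borel ((\<lambda>f. f j) \<circ> (\<lambda>\<omega>. restrict (\<lambda>i. ([R, S, I, J] ! i) \<omega>) {j}))"
      using that by (intro indep_var_compose[OF indep_var_restrict[OF indep]]) auto
    then show ?thesis by (simp add: comp_def)
  qed
  have SR: "indep_var borel S borel R" using pair[of 1 0] by simp
  have IJ: "indep_var borel I borel J" using pair[of 2 3] by simp
  have four: "indep_var (borel \<Otimes>\<^sub>M borel) (\<lambda>\<omega>. (I \<omega>, J \<omega>)) (borel \<Otimes>\<^sub>M borel) (\<lambda>\<omega>. (S \<omega>, R \<omega>))"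
  proof -
    have "indep_var (borel \<Otimes>\<^sub>M borel) ((\<lambda>f. (f 2, f 3)) \<circ> (\<lambda>\<omega>. restrict (\<lambda>i. ([R, S, I, J] ! i) \<omega>) {2,3}))
        (borel \<Otimes>\<^sub>M borel) ((\<lambda>f. (f 1, f 0)) \<circ> (\<lambda>\<omega>. restrict (\<lambda>i. ([R, S, I, J] ! i) \<omega>) {0,1}))"
      by (intro indep_var_compose[OF indep_var_restrict[OF indep]]) auto
    then show ?thesis by (simp add: comp_def)
  qed
  define q where "q v = prob {\<omega>\<in>space M. R \<omega> *\<^sub>R v \<in> A}" for v
  have q0: "q v \<ge> 0" for v by (simp add: q_def)
  have ennq: "(\<integral>\<^sup>+\<omega>. indicator A (R \<omega> *\<^sub>R v) \<partial>M) = ennreal (q v)" for v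
    unfolding q_def by (rule nn_integral_indicator_scaleR) simp_all
  have q[measurable]: "q \<in> borel_measurable borel"
    unfolding q_def by (rule scaleR_prob_measurable) simp_all
  \<comment> \<open>The indicator of the event, as a function of the signs (first component) and of \<open>(S, R)\<close>.\<close>
  define f :: "(real \<times> real) \<times> (real \<times> real) \<Rightarrow> ennreal" where
    "f = (\<lambda>z. indicator A (snd (snd z) *\<^sub>R
        (fst (fst z) * fst (snd z), snd (fst z) * sqrt (1 - (fst (snd z))\<^sup>2))))"
  have f[measurable]: "f \<in> borel_measurable ((borel \<Otimes>\<^sub>M borel) \<Otimes>\<^sub>M (borel \<Otimes>\<^sub>M borel))"
    unfolding f_def by measurable
  \<comment> \<open>The probability of the event, given that the signs are \<open>i\<close> and \<open>j\<close>.\<close>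
  define k where "k i j = (\<integral>\<^sup>+\<theta>\<in>{0..pi/2}. ennreal (W (sin \<theta>) * cos \<theta> * q (i * sin \<theta>, j * cos \<theta>)) \<partial>lborel)" for i j
  have km[measurable]: "(\<lambda>(i, j). k i j) \<in> borel_measurable (borel \<Otimes>\<^sub>M borel)"
    unfolding k_def borel_prod[symmetric] by measurable
  have cond: "(\<integral>\<^sup>+\<omega>. f ((i, j), (S \<omega>, R \<omega>)) \<partial>M) = k i j" for i j
  proof -
    have "(\<integral>\<^sup>+\<omega>. f ((i, j), (S \<omega>, R \<omega>)) \<partial>M) = (\<integral>\<^sup>+\<omega>. \<integral>\<^sup>+\<omega>'. f ((i, j), (S \<omega>, R \<omega>')) \<partial>M \<partial>M)"
      using nn_integral_indep_var[OF SR, of "\<lambda>z. f ((i, j), z)"] by simp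
    also have "\<dots> = (\<integral>\<^sup>+\<omega>. ennreal (q (i * S \<omega>, j * sqrt (1 - (S \<omega>)\<^sup>2))) \<partial>M)"
      by (simp only: f_def fst_conv snd_conv ennq)
    also have "\<dots> = (\<integral>\<^sup>+\<theta>\<in>{0..pi/2}. ennreal (W (sin \<theta>) * cos \<theta> *
        q (i * sin \<theta>, j * sqrt (1 - (sin \<theta>)\<^sup>2))) \<partial>lborel)"
      by (rule nn_integral_arcsin_substitution[OF S W W0]) (auto simp: q0)
    also have "\<dots> = k i j"
      unfolding k_def
      by (intro nn_integral_cong)
         (auto split: split_indicator simp: cos_squared_eq[symmetric] cos_ge_zero)
    finally show ?thesis .
  qed
  have "emeasure M {\<omega>\<in>space M. R \<omega> *\<^sub>R (I \<omega> * S \<omega>, J \<omega> * sqrt (1 - (S \<omega>)\<^sup>2)) \<in> A} =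
      (\<integral>\<^sup>+\<omega>. indicator {\<omega>\<in>space M. R \<omega> *\<^sub>R (I \<omega> * S \<omega>, J \<omega> * sqrt (1 - (S \<omega>)\<^sup>2)) \<in> A} \<omega> \<partial>M)"
    by (rule nn_integral_indicator[symmetric]) measurable
  also have "\<dots> = (\<integral>\<^sup>+\<omega>. f ((I \<omega>, J \<omega>), (S \<omega>, R \<omega>)) \<partial>M)"
    by (intro nn_integral_cong) (auto simp: f_def split: split_indicator)
  also have "\<dots> = (\<integral>\<^sup>+\<omega>. (\<lambda>(i, j). k i j) (I \<omega>, J \<omega>) \<partial>M)"
    using nn_integral_indep_var[OF four f] by (simp add: cond)
  also have "\<dots> = (\<integral>\<^sup>+\<omega>. \<integral>\<^sup>+\<omega>'. k (I \<omega>) (J \<omega>') \<partial>M \<partial>M)"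
    using nn_integral_indep_var[OF IJ km] by simp
  also have "\<dots> = (\<integral>\<^sup>+\<omega>. ennreal (1/2) * (k (I \<omega>) 1 + k (I \<omega>) (-1)) \<partial>M)"
    by (simp add: nn_integral_fair_sign[OF Jm _ J])
  also have "\<dots> = ennreal (1/2) * (ennreal (1/2) * (k 1 1 + k 1 (-1)) + ennreal (1/2) * (k (-1) 1 + k (-1) (-1)))"
    by (subst nn_integral_fair_sign[OF Im _ I]) (simp_all)
  also have "\<dots> = ennreal (1/4) * (k 1 1 + k 1 (-1) + k (-1) 1 + k (-1) (-1))"
  proof -
    have quarter: "ennreal (1/4) = ennreal (1/2) * ennreal (1/2)"
      by (subst ennreal_mult[symmetric]) simp_all
    show ?thesis by (simp only: quarter distrib_left mult.assoc add.assoc)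
  qed
  also have "k 1 1 + k 1 (-1) + k (-1) 1 + k (-1) (-1) =
      (\<integral>\<^sup>+\<theta>\<in>{-pi..pi}. ennreal (W \<bar>sin \<theta>\<bar> * \<bar>cos \<theta>\<bar> * q (sin \<theta>, cos \<theta>)) \<partial>lborel)"
  proof -
    define \<phi> where "\<phi> v = ennreal (W \<bar>fst v\<bar> * \<bar>snd v\<bar> * q v)" for v
    have [measurable]: "q \<in> borel_measurable (borel \<Otimes>\<^sub>M borel)" by (simp add: borel_prod)
    have [measurable]: "\<phi> \<in> borel_measurable borel"
      unfolding \<phi>_def borel_prod[symmetric] by measurable
    have "k i j = (\<integral>\<^sup>+\<theta>\<in>{0..pi/2}. \<phi> (i * sin \<theta>, j * cos \<theta>) \<partial>lborel)"
      if "\<bar>i\<bar> = 1" "\<bar>j\<bar> = 1" for i j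
      unfolding k_def \<phi>_def using that
      by (intro nn_integral_cong) (auto split: split_indicator simp: abs_mult cos_ge_zero sin_ge_zero)
    then show ?thesis using nn_integral_quadrants[of \<phi>] by (simp add: \<phi>_def)
  qed
  finally show ?thesis by (simp add: q_def)
qed

end

section \<open>Tails of projections near the endpoint\<close>

context prob_space
begin

lemma cdf_distr_eq_prob:
  assumes [measurable]: "random_variable borel R"
  shows "cdf (distr M borel R) x = prob {\<omega>\<in>space M. R \<omega> \<le> x}"
  by (simp add: cdf_def measure_distr vimage_def Int_def conj_commute)

lemma prob_gt_eq_one_minus_cdf:
  assumes [measurable]: "random_variable borel R"
  shows "prob {\<omega>\<in>space M. R \<omega> > x} = 1 - cdf (distr M borel R) x"
proof -
  have "{\<omega>\<in>space M. R \<omega> > x} = space M - {\<omega>\<in>space M. R \<omega> \<le> x}" by auto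
  then show ?thesis by (simp add: cdf_distr_eq_prob prob_compl)
qed

lemma prob_gt_pos_below_right_endpoint:
  assumes R[measurable]: "random_variable borel R"
    and x: "ereal x < right_endpoint (cdf (distr M borel R))"
  shows "prob {\<omega>\<in>space M. R \<omega> > x} > 0"
proof -
  obtain y where "cdf (distr M borel R) y < 1" "x < y"
    using x unfolding right_endpoint_def less_SUP_iff by auto
  moreover have "cdf (distr M borel R) x \<le> cdf (distr M borel R) y"
    unfolding cdf_distr_eq_prob[OF R] using \<open>x < y\<close> by (intro finite_measure_mono) auto
  ultimately show ?thesis by (simp add: prob_gt_eq_one_minus_cdf)
qed

lemma AE_le_right_endpoint:
  assumes R[measurable]: "random_variable borel R"
    and r: "right_endpoint (cdf (distr M borel R)) = ereal r"
  shows "AE \<omega> in M. R \<omega> \<le> r"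
proof -
  have "AE \<omega> in M. R \<omega> \<le> r + inverse (real (Suc n))" for n
  proof -
    have "\<not> cdf (distr M borel R) (r + inverse (real (Suc n))) < 1"
    proof
      assume "cdf (distr M borel R) (r + inverse (real (Suc n))) < 1"
      then have "ereal (r + inverse (real (Suc n))) \<le> right_endpoint (cdf (distr M borel R))"
        unfolding right_endpoint_def by (intro SUP_upper) simp
      then show False using r by simp
    qed
    then have "prob {\<omega>\<in>space M. R \<omega> > r + inverse (real (Suc n))} = 0"
      using prob_gt_eq_one_minus_cdf[OF R, of "r + inverse (real (Suc n))"] by (smt (verit) measure_nonneg)
    then have "AE \<omega> in M. \<omega> \<notin> {\<omega>\<in>space M. R \<omega> > r + inverse (real (Suc n))}"
      by (subst (asm) prob_eq_0) simp_all
    then show ?thesis by (rule AE_mp) (rule AE_I2, simp add: not_less)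
  qed
  then have "AE \<omega> in M. \<forall>n. R \<omega> \<le> r + inverse (real (Suc n))" by (simp add: AE_all_countable)
  then show ?thesis
  proof (rule AE_mp, intro AE_I2 impI)
    fix \<omega> assume *: "\<forall>n. R \<omega> \<le> r + inverse (real (Suc n))"
    show "R \<omega> \<le> r"
    proof (rule ccontr)
      assume "\<not> R \<omega> \<le> r"
      then obtain n where "inverse (real (Suc n)) < R \<omega> - r" using reals_Archimedean[of "R \<omega> - r"] by auto
      with * show False by (smt (verit))
    qed
  qed
qed

definition radial_tail :: "('a \<Rightarrow> real) \<Rightarrow> real \<Rightarrow> real \<Rightarrow> real" where
  "radial_tail R u t = prob {\<omega>\<in>space M. R \<omega> * cos t > u}"

text \<open>
  Up to the factor \<open>1/(2\<pi>)\<close>, when \<open>R\<close> is positive, this is the tail at \<open>u > 0\<close> of a linear projection of \<open>R\<close> times a uniform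
  point of the circle; angles beyond a right angle would contribute nothing to it. It is the common yardstick
  for the tails of all \<open>U(\<rho>)\<close>.
\<close>

definition uniform_angle_tail :: "('a \<Rightarrow> real) \<Rightarrow> real \<Rightarrow> ennreal" where
  "uniform_angle_tail R u = (\<integral>\<^sup>+t\<in>{-(pi/2)..pi/2}. ennreal (radial_tail R u t) \<partial>lborel)"

lemma radial_tail_nonneg [simp]: "radial_tail R u t \<ge> 0"
  by (simp add: radial_tail_def)

lemma radial_tail_measurable [measurable]:
  assumes [measurable]: "random_variable borel R"
  shows "radial_tail R u \<in> borel_measurable borel"
proof -
  have "ennreal (radial_tail R u t) = (\<integral>\<^sup>+\<omega>. indicator {u<..} (R \<omega> * cos t) \<partial>M)" for t
  proof -
    have "(\<integral>\<^sup>+\<omega>. indicator {u<..} (R \<omega> * cos t) \<partial>M) = (\<integral>\<^sup>+\<omega>. indicator {\<omega>\<in>space M. R \<omega> * cos t > u} \<omega> \<partial>M)"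
      by (intro nn_integral_cong) (auto split: split_indicator)
    then show ?thesis by (simp add: radial_tail_def emeasure_eq_measure)
  qed
  then have "radial_tail R u t = enn2real (\<integral>\<^sup>+\<omega>. indicator {u<..} (R \<omega> * cos t) \<partial>M)" for t
    by (metis enn2real_ennreal radial_tail_nonneg)
  then have "radial_tail R u = (\<lambda>t. enn2real (\<integral>\<^sup>+\<omega>. indicator {u<..} (R \<omega> * cos t) \<partial>M))" by blast
  then show ?thesis by simp
qed

lemma radial_tail_eq_0:
  assumes [measurable]: "random_variable borel R"
    and R01: "AE \<omega> in M. 0 < R \<omega>" "AE \<omega> in M. R \<omega> \<le> 1" and u: "0 < u" "cos t \<le> u"
  shows "radial_tail R u t = 0"
proof -
  have bound: "R \<omega> * cos t \<le> u" if "0 < R \<omega>" "R \<omega> \<le> 1" for \<omega>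
  proof (cases "cos t \<le> 0")
    case True
    then have "R \<omega> * cos t \<le> 0" using that by (simp add: mult_nonneg_nonpos)
    then show ?thesis using u by simp
  next
    case False
    then have "R \<omega> * cos t \<le> 1 * cos t" using that by (intro mult_right_mono) auto
    then show ?thesis using u by simp
  qed
  have "AE \<omega> in M. \<not> R \<omega> * cos t > u"
    by (rule AE_mp[OF R01(1) AE_mp[OF R01(2) AE_I2]]) (auto simp: not_less bound)
  then show ?thesis unfolding radial_tail_def by (subst prob_eq_0) auto
qed

lemma uniform_angle_tail_finite: "uniform_angle_tail R u < \<infinity>"
proof -
  have "uniform_angle_tail R u \<le> (\<integral>\<^sup>+t. indicator {-(pi/2)..pi/2} t \<partial>lborel)"
    unfolding uniform_angle_tail_def
    by (intro nn_integral_mono) (auto simp: radial_tail_def split: split_indicator)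
  also have "\<dots> < \<infinity>" by simp
  finally show ?thesis .
qed

text \<open>
  With \<open>m\<close> strictly between \<open>u\<close> and 1, the event \<open>R > u / m\<close> has positive probability and entails
  \<open>R cos t > u\<close> for every \<open>t\<close> in the nondegenerate interval on which \<open>cos t \<ge> m\<close>.
\<close>

lemma uniform_angle_tail_pos:
  assumes [measurable]: "random_variable borel R"
    and tail: "\<And>x. x < 1 \<Longrightarrow> prob {\<omega>\<in>space M. R \<omega> > x} > 0"
    and u: "0 < u" "u < 1"
  shows "uniform_angle_tail R u > 0"
proof -
  define m \<delta> c where "m = (1 + u) / 2" and "\<delta> = arccos m" and "c = prob {\<omega>\<in>space M. R \<omega> > u / m}"
  have m: "u < m" "m < 1" "0 < m" using u by (auto simp: m_def)
  have cosd: "cos \<delta> = m" unfolding \<delta>_def using m by (intro cos_arccos) auto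
  have d: "0 < \<delta>" "\<delta> < pi / 2"
    using m arccos_less_mono[of 1 m] arccos_less_mono[of m 0] by (auto simp: \<delta>_def)
  have c: "c > 0" using m by (auto simp: c_def intro!: tail)
  have "c \<le> radial_tail R u t" if "\<bar>t\<bar> \<le> \<delta>" for t
  proof -
    have "m \<le> cos t" using cos_monotone_0_pi_le[of "\<bar>t\<bar>" \<delta>] that d cosd by simp
    then have "u < R \<omega> * cos t" if "u / m < R \<omega>" for \<omega>
    proof -
      have "u < R \<omega> * m" using that m by (simp add: field_simps)
      also have "\<dots> \<le> R \<omega> * cos t"
      proof (rule mult_left_mono)
        have "0 < u / m" using m u by simp
        then show "0 \<le> R \<omega>" using that by linarith
      qed fact
      finally show ?thesis .
    qed
    then show ?thesis unfolding c_def radial_tail_def by (intro finite_measure_mono) auto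
  qed
  then have "(\<integral>\<^sup>+t. ennreal c * indicator {-\<delta>..\<delta>} t \<partial>lborel) \<le> uniform_angle_tail R u"
    unfolding uniform_angle_tail_def using d
    by (intro nn_integral_mono) (auto split: split_indicator intro!: ennreal_leI)
  moreover have "(\<integral>\<^sup>+t. ennreal c * indicator {-\<delta>..\<delta>} t \<partial>lborel) = ennreal (c * (2 * \<delta>))"
    using d c by (simp add: nn_integral_cmult_indicator ennreal_mult)
  moreover have "ennreal (c * (2 * \<delta>)) > 0" using d c by simp
  ultimately show ?thesis by (metis less_le_trans)
qed

text \<open>
  Exceeding \<open>u > cos \<delta>\<close> with a radius at most 1 forces the angle to be within \<open>\<delta>\<close> of the projection direction.
\<close>

lemma uniform_angle_tail_localized:
  assumes R[measurable]: "random_variable borel R"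
    and R01: "AE \<omega> in M. 0 < R \<omega>" "AE \<omega> in M. R \<omega> \<le> 1"
    and \<delta>: "0 \<le> \<delta>" "\<delta> < pi / 2" and u: "cos \<delta> < u"
  shows "uniform_angle_tail R u = (\<integral>\<^sup>+\<theta>\<in>{\<alpha> - \<delta>..\<alpha> + \<delta>}. ennreal (radial_tail R u (\<theta> - \<alpha>)) \<partial>lborel)"
proof -
  have "0 < cos \<delta>" using \<delta> by (intro cos_gt_zero_pi) auto
  have z: "radial_tail R u t = 0" if "\<delta> \<le> \<bar>t\<bar>" "\<bar>t\<bar> \<le> 3 * pi / 2" for t
    using cos_le_cos_of_abs_ge[of \<delta> t] that \<delta> u \<open>0 < cos \<delta>\<close> by (intro radial_tail_eq_0 R R01) auto
  have "(\<integral>\<^sup>+\<theta>\<in>{\<alpha> - \<delta>..\<alpha> + \<delta>}. ennreal (radial_tail R u (\<theta> - \<alpha>)) \<partial>lborel) =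
      (\<integral>\<^sup>+t\<in>{-\<delta>..\<delta>}. ennreal (radial_tail R u t) \<partial>lborel)"
    using nn_integral_Icc_shift[where f="\<lambda>t. ennreal (radial_tail R u t)" and t="-\<alpha>" and a="\<alpha> - \<delta>" and b="\<alpha> + \<delta>"]
    by simp
  also have "\<dots> = uniform_angle_tail R u"
    unfolding uniform_angle_tail_def using \<delta>
    by (intro nn_integral_cong) (auto split: split_indicator intro!: z)
  finally show ?thesis by simp
qed

text \<open>
  The tail of a projection sees the angular density only in the direction of projection: for \<open>u > cos \<delta>\<close>
  the integrand lives on \<open>\<bar>\<theta> - \<alpha>\<bar> \<le> \<delta>\<close>, where \<open>H\<close> is within \<open>\<epsilon>\<close> of \<open>H \<alpha>\<close>, so \<open>p u\<close> lies between
  \<open>(H \<alpha> - \<epsilon>)\<close> and \<open>(H \<alpha> + \<epsilon>)\<close> times \<open>uniform_angle_tail R u\<close>.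
\<close>

lemma angular_tail_asymptotics:
  fixes H p :: "real \<Rightarrow> real"
  assumes R[measurable]: "random_variable borel R"
    and R01: "AE \<omega> in M. 0 < R \<omega>" "AE \<omega> in M. R \<omega> \<le> 1"
    and tail: "\<And>x. x < 1 \<Longrightarrow> prob {\<omega>\<in>space M. R \<omega> > x} > 0"
    and \<alpha>: "0 < \<alpha>" "\<alpha> < pi / 2"
    and H: "\<And>\<theta>. H \<theta> \<ge> 0" "isCont H \<alpha>"
    and p: "\<And>u. ennreal (p u) = (\<integral>\<^sup>+\<theta>\<in>{-pi..pi}. ennreal (H \<theta> * radial_tail R u (\<theta> - \<alpha>)) \<partial>lborel)"
    and p0: "\<And>u. p u \<ge> 0"
  shows "((\<lambda>u. p u / enn2real (uniform_angle_tail R u)) \<longlongrightarrow> H \<alpha>) (at_left 1)"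
proof (rule tendstoI)
  fix e :: real assume "e > 0"
  define \<epsilon> where "\<epsilon> = e / 2"
  have "\<epsilon> > 0" "\<epsilon> < e" using \<open>e > 0\<close> by (auto simp: \<epsilon>_def)
  obtain d where d: "d > 0" "\<And>\<theta>. \<bar>\<theta> - \<alpha>\<bar> < d \<Longrightarrow> \<bar>H \<theta> - H \<alpha>\<bar> < \<epsilon>"
    using H(2) \<open>\<epsilon> > 0\<close> unfolding continuous_at_eps_delta dist_real_def by (metis)
  \<comment> \<open>Small enough for continuity of \<open>H\<close>, and for \<open>[\<alpha> - \<delta>, \<alpha> + \<delta>]\<close> to stay in the first quadrant.\<close>
  define \<delta> where "\<delta> = min (d / 2) (min \<alpha> (pi / 2 - \<alpha>))"
  have \<delta>: "0 < \<delta>" "\<delta> < d" "\<delta> \<le> \<alpha>" "\<delta> \<le> pi / 2 - \<alpha>" "\<delta> < pi / 2"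
    using d \<alpha> by (auto simp: \<delta>_def min_def)
  have near: "\<bar>H \<theta> - H \<alpha>\<bar> < \<epsilon>" if "\<bar>\<theta> - \<alpha>\<bar> \<le> \<delta>" for \<theta> using d(2)[of \<theta>] that \<delta> by auto
  have cpos: "0 < cos \<delta>" using \<delta> by (intro cos_gt_zero_pi) auto
  have "cos \<delta> < cos 0" using \<delta> by (intro cos_monotone_0_pi) auto
  then have "eventually (\<lambda>u. u \<in> {cos \<delta><..<1}) (at_left 1)"
    by (intro eventually_at_left_real) simp
  then show "eventually (\<lambda>u. dist (p u / enn2real (uniform_angle_tail R u)) (H \<alpha>) < e) (at_left 1)"
  proof eventually_elim
    case (elim u)
    then have u: "cos \<delta> < u" "0 < u" "u < 1" using cpos by auto
    have z: "radial_tail R u t = 0" if "\<delta> \<le> \<bar>t\<bar>" "\<bar>t\<bar> \<le> 3 * pi / 2" for t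
      using cos_le_cos_of_abs_ge[of \<delta> t] that \<delta> u by (intro radial_tail_eq_0 R R01) auto
    let ?r = "\<lambda>\<theta>. ennreal (radial_tail R u (\<theta> - \<alpha>))"
    have K: "uniform_angle_tail R u = (\<integral>\<^sup>+\<theta>\<in>{\<alpha> - \<delta>..\<alpha> + \<delta>}. ?r \<theta> \<partial>lborel)"
      using \<delta> u by (intro uniform_angle_tail_localized R R01) auto
    define \<kappa> where "\<kappa> = enn2real (uniform_angle_tail R u)"
    have \<kappa>: "uniform_angle_tail R u = ennreal \<kappa>" "\<kappa> > 0"
      using uniform_angle_tail_finite[of R u] uniform_angle_tail_pos[OF R tail u(2,3)]
      by (auto simp: \<kappa>_def enn2real_positive_iff)
    have "ennreal (H \<alpha> - \<epsilon>) * ennreal \<kappa> = (\<integral>\<^sup>+\<theta>. ennreal (H \<alpha> - \<epsilon>) * (?r \<theta> * indicator {\<alpha> - \<delta>..\<alpha> + \<delta>} \<theta>) \<partial>lborel)"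
      unfolding \<kappa>(1)[symmetric] K by (rule nn_integral_cmult[symmetric]) simp
    also have "\<dots> \<le> (\<integral>\<^sup>+\<theta>\<in>{-pi..pi}. ennreal (H \<theta> * radial_tail R u (\<theta> - \<alpha>)) \<partial>lborel)"
    proof (rule nn_integral_mono)
      fix \<theta>
      show "ennreal (H \<alpha> - \<epsilon>) * (?r \<theta> * indicator {\<alpha> - \<delta>..\<alpha> + \<delta>} \<theta>)
          \<le> ennreal (H \<theta> * radial_tail R u (\<theta> - \<alpha>)) * indicator {-pi..pi} \<theta>"
      proof (cases "\<theta> \<in> {\<alpha> - \<delta>..\<alpha> + \<delta>}")
        case True
        then have "H \<alpha> - \<epsilon> \<le> H \<theta>" "\<theta> \<in> {-pi..pi}"
          using near[of \<theta>] \<delta> \<alpha> by (auto simp: abs_le_iff)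
        then show ?thesis using True H(1)
          by (auto simp: ennreal_mult'' intro!: mult_right_mono ennreal_leI)
      qed simp
    qed
    finally have lo: "ennreal (H \<alpha> - \<epsilon>) * ennreal \<kappa> \<le> ennreal (p u)" unfolding p .
    have "ennreal (p u) \<le> (\<integral>\<^sup>+\<theta>. ennreal (H \<alpha> + \<epsilon>) * (?r \<theta> * indicator {\<alpha> - \<delta>..\<alpha> + \<delta>} \<theta>) \<partial>lborel)"
      unfolding p
    proof (rule nn_integral_mono)
      fix \<theta>
      show "ennreal (H \<theta> * radial_tail R u (\<theta> - \<alpha>)) * indicator {-pi..pi} \<theta>
          \<le> ennreal (H \<alpha> + \<epsilon>) * (?r \<theta> * indicator {\<alpha> - \<delta>..\<alpha> + \<delta>} \<theta>)"
      proof (cases "\<theta> \<in> {\<alpha> - \<delta>..\<alpha> + \<delta>}")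
        case True
        then have "H \<theta> \<le> H \<alpha> + \<epsilon>" using near[of \<theta>] by (auto simp: abs_le_iff)
        then show ?thesis using True H(1)
          by (auto simp: ennreal_mult'' intro!: mult_right_mono ennreal_leI split: split_indicator)
      next
        case False
        then have "\<theta> \<in> {-pi..pi} \<Longrightarrow> radial_tail R u (\<theta> - \<alpha>) = 0"
          using \<delta> \<alpha> by (intro z) auto
        then show ?thesis by (auto split: split_indicator)
      qed
    qed
    also have "\<dots> = ennreal (H \<alpha> + \<epsilon>) * ennreal \<kappa>"
      unfolding \<kappa>(1)[symmetric] K by (rule nn_integral_cmult) simp
    finally have hi: "ennreal (p u) \<le> ennreal (H \<alpha> + \<epsilon>) * ennreal \<kappa>" .
    \<comment> \<open>\<open>ennreal\<close> truncates a negative lower factor to 0; the bound then holds because \<open>p u \<ge> 0\<close>.\<close>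
    have "(H \<alpha> - \<epsilon>) * \<kappa> \<le> p u"
    proof (cases "H \<alpha> - \<epsilon> \<ge> 0")
      case True
      then show ?thesis using lo \<kappa> p0[of u] by (simp add: ennreal_mult[symmetric])
    next
      case False
      then have "(H \<alpha> - \<epsilon>) * \<kappa> \<le> 0" using \<kappa> by (intro mult_nonpos_nonneg) auto
      then show ?thesis using p0[of u] by simp
    qed
    moreover have "p u \<le> (H \<alpha> + \<epsilon>) * \<kappa>"
      using hi \<kappa> H(1)[of \<alpha>] \<open>\<epsilon> > 0\<close> by (simp add: ennreal_mult[symmetric] del: ennreal_plus)
    ultimately have "\<bar>p u / \<kappa> - H \<alpha>\<bar> \<le> \<epsilon>" using \<kappa>(2) by (simp add: abs_le_iff field_simps)
    then show ?case using \<open>\<epsilon> < e\<close> by (simp add: dist_real_def \<kappa>_def)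
  qed
qed

end

section \<open>Sphericity and asymptotically equal tails\<close>

theorem theorem4p4:
  fixes M :: "'a measure" and N :: "'b measure"
    and R S I\<^sub>1 I\<^sub>2 :: "'a \<Rightarrow> real"
    and F g :: "real \<Rightarrow> real"
    and U :: "'b \<Rightarrow> real \<times> real"
    and \<gamma> :: real
  assumes "prob_space M" and "prob_space N"
    and indep: "prob_space.indep_vars M (\<lambda>_. borel) (\<lambda>i. [R, S, I\<^sub>1, I\<^sub>2] ! i) {..<4}"
    and R_pos: "AE \<omega> in M. R \<omega> > 0"
    and F: "F = cdf (distr M borel R)"
    and S_range: "AE \<omega> in M. S \<omega> \<in> {0<..<1}"
    and g_cont: "continuous_on {0<..<1} g"
    and g_nonneg: "\<forall>s\<in>{0<..<1}. g s \<ge> 0"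
    and S_density: "distributed M lborel S (\<lambda>s. ennreal (g s * indicator {0<..<1} s))"
    and I1: "\<P>(\<omega> in M. I\<^sub>1 \<omega> = 1) = 1/2" "\<P>(\<omega> in M. I\<^sub>1 \<omega> = -1) = 1/2"
    and I2: "\<P>(\<omega> in M. I\<^sub>2 \<omega> = 1) = 1/2" "\<P>(\<omega> in M. I\<^sub>2 \<omega> = -1) = 1/2"
    and U_meas: "U \<in> borel_measurable N"
    and U_distr: "distr N borel U =
        distr M borel (\<lambda>\<omega>. R \<omega> *\<^sub>R (I\<^sub>1 \<omega> * S \<omega>, I\<^sub>2 \<omega> * sqrt (1 - (S \<omega>)\<^sup>2)))"
    and gamma: "\<gamma> > 0"
    and mda: "weibull_mda \<gamma> F"
    and endpoint: "right_endpoint F = 1"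
  shows "(\<forall>\<rho>\<in>{0<..<1}.
            ((\<lambda>u. \<P>(\<omega> in N. \<rho> * fst (U \<omega>) + sqrt (1 - \<rho>\<^sup>2) * snd (U \<omega>) > u)
                  / \<P>(\<omega> in N. fst (U \<omega>) > u)) \<longlongrightarrow> 1) (at_left 1))
         \<longleftrightarrow> spherical N U"
proof -
  interpret M: prob_space M by fact
  interpret N: prob_space N by fact
  \<comment> \<open>The density of \<open>S\<close> on the whole line, extended by 0: the values of \<open>g\<close> outside \<open>(0, 1)\<close> are arbitrary.\<close>
  define W where "W s = g s * indicator {0<..<1} s" for s
  have W0: "W s \<ge> 0" for s using g_nonneg by (auto simp: W_def indicator_def)
  have Wout: "W s = 0" if "s \<notin> {0<..<1}" for s using that by (auto simp: W_def)
  have Wout': "W s = 0" if "s \<notin> {0..1}" for s using that by (intro Wout) auto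
  have S_density: "distributed M lborel S (\<lambda>s. ennreal (W s))" using S_density by (simp add: W_def)
  have Wm[measurable]: "W \<in> borel_measurable borel"
  proof -
    have "(\<lambda>s. enn2real (ennreal (W s))) \<in> borel_measurable borel"
      using distributed_borel_measurable[OF S_density] by simp
    then show ?thesis by (simp add: W0)
  qed
  have rv: "[R, S, I\<^sub>1, I\<^sub>2] ! i \<in> borel_measurable M" if "i < 4" for i
    using indep that unfolding M.indep_vars_def by auto
  have Rm[measurable]: "R \<in> borel_measurable M" and [measurable]: "S \<in> borel_measurable M"
    and [measurable]: "I\<^sub>1 \<in> borel_measurable M" "I\<^sub>2 \<in> borel_measurable M"
    using rv[of 0] rv[of 1] rv[of 2] rv[of 3] by simp_all
  note U_meas[measurable]
  have tail_pos: "M.prob {\<omega>\<in>space M. R \<omega> > x} > 0" if "x < 1" for x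
    using endpoint that by (intro M.prob_gt_pos_below_right_endpoint Rm) (simp add: F)
  have R_le: "AE \<omega> in M. R \<omega> \<le> 1"
    using endpoint by (intro M.AE_le_right_endpoint Rm) (simp add: F one_ereal_def)
  \<comment> \<open>Four times the density of the angle on \<open>[-\<pi>, \<pi>]\<close>.\<close>
  define H where "H \<theta> = W \<bar>sin \<theta>\<bar> * \<bar>cos \<theta>\<bar>" for \<theta>
  have [measurable]: "H \<in> borel_measurable borel" unfolding H_def by measurable
  have H0: "H \<theta> \<ge> 0" for \<theta> by (simp add: H_def W0)
  have polar: "emeasure (distr N borel U) A = ennreal (1/4) * (\<integral>\<^sup>+\<theta>\<in>{-pi..pi}. ennreal (H \<theta> *
        M.prob {\<omega>\<in>space M. R \<omega> *\<^sub>R (sin \<theta>, cos \<theta>) \<in> A}) \<partial>lborel)" if [measurable]: "A \<in> sets borel" for A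
  proof -
    have "emeasure (distr N borel U) A =
        emeasure M {\<omega>\<in>space M. R \<omega> *\<^sub>R (I\<^sub>1 \<omega> * S \<omega>, I\<^sub>2 \<omega> * sqrt (1 - (S \<omega>)\<^sup>2)) \<in> A}"
      unfolding U_distr by (subst emeasure_distr) (auto intro!: arg_cong[where f="emeasure M"])
    also have "\<dots> = ennreal (1/4) * (\<integral>\<^sup>+\<theta>\<in>{-pi..pi}. ennreal (H \<theta> *
        M.prob {\<omega>\<in>space M. R \<omega> *\<^sub>R (sin \<theta>, cos \<theta>) \<in> A}) \<partial>lborel)"
      unfolding H_def by (intro M.polar_probability[OF indep S_density Wm W0] Wout' I1 I2 that)
    finally show ?thesis .
  qed
  define P where "P \<rho> u = \<P>(\<omega> in N. \<rho> * fst (U \<omega>) + sqrt (1 - \<rho>\<^sup>2) * snd (U \<omega>) > u)" for \<rho> u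
  define P1 where "P1 u = \<P>(\<omega> in N. fst (U \<omega>) > u)" for u
  define \<kappa> where "\<kappa> u = enn2real (M.uniform_angle_tail R u)" for u
  have half_plane_borel [measurable]: "{v::real \<times> real. \<rho> * fst v + \<sigma> * snd v > u} \<in> sets borel" for \<rho> \<sigma> u
    by (intro borel_open open_Collect_less continuous_intros)
  have half_plane: "N.prob {\<omega>\<in>space N. \<rho> * fst (U \<omega>) + \<sigma> * snd (U \<omega>) > u} =
      measure (distr N borel U) {v. \<rho> * fst v + \<sigma> * snd v > u}" for \<rho> \<sigma> u
    by (subst measure_distr) (auto intro!: arg_cong[where f=N.prob])
  have lim: "((\<lambda>u. P \<rho> u / \<kappa> u) \<longlongrightarrow> g \<rho> * sqrt (1 - \<rho>\<^sup>2) / 4) (at_left 1)"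
    if \<rho>: "0 < \<rho>" "\<rho> < 1" for \<rho>
  proof -
    define \<alpha> where "\<alpha> = arcsin \<rho>"
    have \<alpha>: "0 < \<alpha>" "\<alpha> < pi / 2" "sin \<alpha> = \<rho>"
      using \<rho> arcsin_less_mono[of 0 \<rho>] arcsin_less_mono[of \<rho> 1] by (auto simp: \<alpha>_def)
    have ca: "cos \<alpha> = sqrt (1 - \<rho>\<^sup>2)" using \<rho> by (simp add: \<alpha>_def cos_arcsin)
    have p: "ennreal (4 * P \<rho> u) = (\<integral>\<^sup>+\<theta>\<in>{-pi..pi}. ennreal (H \<theta> * M.radial_tail R u (\<theta> - \<alpha>)) \<partial>lborel)" for u
    proof -
      let ?A = "{v::real\<times>real. \<rho> * fst v + sqrt (1 - \<rho>\<^sup>2) * snd v > u}"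
      have A: "?A \<in> sets borel" by (rule half_plane_borel)
      have "R \<omega> *\<^sub>R (sin \<theta>, cos \<theta>) \<in> ?A \<longleftrightarrow> R \<omega> * cos (\<theta> - \<alpha>) > u" for \<omega> \<theta>
        by (simp add: cos_diff \<alpha>(3) ca algebra_simps)
      then have r: "M.prob {\<omega>\<in>space M. R \<omega> *\<^sub>R (sin \<theta>, cos \<theta>) \<in> ?A} = M.radial_tail R u (\<theta> - \<alpha>)" for \<theta>
        unfolding M.radial_tail_def by simp
      interpret D: prob_space "distr N borel U" by (rule N.prob_space_distr) simp
      have "ennreal (4 * P \<rho> u) = ennreal 4 * emeasure (distr N borel U) ?A"
        unfolding P_def half_plane D.emeasure_eq_measure by (rule ennreal_mult) simp_all
      also have "\<dots> = (ennreal 4 * ennreal (1/4)) * (\<integral>\<^sup>+\<theta>\<in>{-pi..pi}. ennreal (H \<theta> * M.radial_tail R u (\<theta> - \<alpha>)) \<partial>lborel)"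
        unfolding polar[OF A] r by (simp only: mult.assoc)
      also have "ennreal 4 * ennreal (1/4) = 1" by (subst ennreal_mult[symmetric]) simp_all
      finally show ?thesis by simp
    qed
    have gc: "isCont g (sin \<alpha>)"
      using g_cont \<rho> \<alpha>(3) by (simp add: continuous_on_eq_continuous_at)
    have "isCont (\<lambda>\<theta>. g (sin \<theta>) * cos \<theta>) \<alpha>"
      by (intro continuous_intros isCont_o2[where f=sin and g=g] gc)
    moreover have "eventually (\<lambda>\<theta>. g (sin \<theta>) * cos \<theta> = H \<theta>) (nhds \<alpha>)"
    proof -
      have "eventually (\<lambda>\<theta>. \<theta> \<in> {0<..<pi/2}) (nhds \<alpha>)"
        using \<alpha> by (intro eventually_nhds_in_open) auto
      then show ?thesis
      proof eventually_elim
        case (elim \<theta>)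
        then have "0 < sin \<theta>" "0 < cos \<theta>" by (auto intro!: sin_gt_zero cos_gt_zero)
        moreover have "sin \<theta> < 1" using elim sin_monotone_2pi[of \<theta> "pi/2"] by simp
        ultimately show ?case by (simp add: H_def W_def)
      qed
    qed
    ultimately have Hc: "isCont H \<alpha>" using isCont_cong[of "\<lambda>\<theta>. g (sin \<theta>) * cos \<theta>" H \<alpha>] by simp
    have "((\<lambda>u. 4 * P \<rho> u / \<kappa> u) \<longlongrightarrow> H \<alpha>) (at_left 1)"
      unfolding \<kappa>_def
      by (rule M.angular_tail_asymptotics[OF Rm R_pos R_le tail_pos \<alpha>(1,2) H0 Hc p]) (auto simp: P_def)
    then have "((\<lambda>u. (4 * P \<rho> u / \<kappa> u) / 4) \<longlongrightarrow> H \<alpha> / 4) (at_left 1)"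
      by (intro tendsto_divide) auto
    moreover have "H \<alpha> = g \<rho> * sqrt (1 - \<rho>\<^sup>2)"
      unfolding H_def \<alpha>(3) ca using \<rho> by (simp add: W_def power_le_one)
    ultimately show ?thesis by simp
  qed
  \<comment> \<open>A reference direction in which the density is positive; it exists because \<open>g\<close> integrates to 1.\<close>
  have "\<exists>\<rho>\<^sub>0. 0 < \<rho>\<^sub>0 \<and> \<rho>\<^sub>0 < 1 \<and> g \<rho>\<^sub>0 > 0"
  proof (rule ccontr)
    assume none: "\<not> ?thesis"
    have "W s = 0" for s
    proof (cases "s \<in> {0<..<1}")
      case True
      then have "g s \<ge> 0" "\<not> g s > 0" using g_nonneg none by auto
      then show ?thesis by (simp add: W_def)
    qed (rule Wout)
    then show False
      using distributed_nn_integral[OF S_density, of "\<lambda>_. 1"] M.emeasure_space_1 by simp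
  qed
  then obtain \<rho>\<^sub>0 where \<rho>\<^sub>0: "0 < \<rho>\<^sub>0" "\<rho>\<^sub>0 < 1" "g \<rho>\<^sub>0 > 0" by blast
  define c where "c = g \<rho>\<^sub>0 * sqrt (1 - \<rho>\<^sub>0\<^sup>2)"
  have c: "c > 0" using \<rho>\<^sub>0 by (simp add: c_def abs_square_less_1)
  have lim0: "((\<lambda>u. P \<rho>\<^sub>0 u / \<kappa> u) \<longlongrightarrow> c / 4) (at_left 1)"
    unfolding c_def using lim \<rho>\<^sub>0 by blast
  have ev0: "eventually (\<lambda>u. P \<rho>\<^sub>0 u / \<kappa> u > 0) (at_left 1)"
    using order_tendstoD(1)[OF lim0, of 0] c by simp
  show ?thesis
    unfolding P_def[symmetric] P1_def[symmetric]
  proof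
    assume equiv: "\<forall>\<rho>\<in>{0<..<1}. ((\<lambda>u. P \<rho> u / P1 u) \<longlongrightarrow> 1) (at_left 1)"
    have const: "g \<rho> * sqrt (1 - \<rho>\<^sup>2) = c" if \<rho>: "0 < \<rho>" "\<rho> < 1" for \<rho>
    proof -
      have e: "((\<lambda>u. P \<rho> u / P1 u) \<longlongrightarrow> 1) (at_left 1)" "((\<lambda>u. P \<rho>\<^sub>0 u / P1 u) \<longlongrightarrow> 1) (at_left 1)"
        using equiv \<rho> \<rho>\<^sub>0 by auto
      \<comment> \<open>The unknown behaviour of \<open>P1\<close> cancels when two directions \<open>\<rho>\<close> and \<open>\<rho>\<^sub>0\<close> are compared.\<close>
      have ratio: "((\<lambda>u. (P \<rho> u / P1 u) / (P \<rho>\<^sub>0 u / P1 u)) \<longlongrightarrow> 1 / 1) (at_left 1)"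
        by (rule tendsto_divide[OF e]) simp
      have "eventually (\<lambda>u. 0 < P \<rho>\<^sub>0 u / P1 u) (at_left 1)"
        using order_tendstoD(1)[OF e(2), of 0] by simp
      then have "eventually (\<lambda>u. (P \<rho> u / P1 u) / (P \<rho>\<^sub>0 u / P1 u) = (P \<rho> u / \<kappa> u) / (P \<rho>\<^sub>0 u / \<kappa> u)) (at_left 1)"
        using ev0
      proof eventually_elim
        case (elim u)
        then have "P1 u \<noteq> 0" "\<kappa> u \<noteq> 0" by auto
        then show ?case by simp
      qed
      from Lim_transform_eventually[OF ratio this]
      have 1: "((\<lambda>u. (P \<rho> u / \<kappa> u) / (P \<rho>\<^sub>0 u / \<kappa> u)) \<longlongrightarrow> 1 / 1) (at_left 1)" .
      have 2: "((\<lambda>u. (P \<rho> u / \<kappa> u) / (P \<rho>\<^sub>0 u / \<kappa> u)) \<longlongrightarrow> (g \<rho> * sqrt (1 - \<rho>\<^sup>2) / 4) / (c / 4)) (at_left 1)"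
        by (rule tendsto_divide[OF lim[OF \<rho>] lim0]) (use c in simp)
      have "1 / 1 = (g \<rho> * sqrt (1 - \<rho>\<^sup>2) / 4) / (c / 4)"
        by (rule tendsto_unique[OF trivial_limit_at_left_real 1 2])
      then show ?thesis using c by simp
    qed
    have H_ae: "AE \<theta> in lborel. \<theta> \<in> {-pi..pi} \<longrightarrow> H \<theta> = c"
    proof -
      \<comment> \<open>Where \<open>sin \<theta>\<close> or \<open>cos \<theta>\<close> vanishes, \<open>\<bar>sin \<theta>\<bar>\<close> leaves \<open>(0, 1)\<close>.\<close>
      have "AE \<theta> in lborel. \<theta> \<notin> {-pi, -(pi/2), 0, pi/2, pi}"
        by (intro AE_I'[of "{-pi, -(pi/2), 0, pi/2, pi::real}"] countable_imp_null_set_lborel) auto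
      then show ?thesis
      proof eventually_elim
        case (elim \<theta>)
        show ?case
        proof
          assume \<theta>: "\<theta> \<in> {-pi..pi}"
          have s: "sin \<theta> \<noteq> 0"
          proof (cases "0 < \<theta>")
            case True
            then have "0 < sin \<theta>" using elim \<theta> by (intro sin_gt_zero) auto
            then show ?thesis by simp
          next
            case False
            then have "0 < sin (-\<theta>)" using elim \<theta> by (intro sin_gt_zero) auto
            then show ?thesis by simp
          qed
          have "cos \<theta> \<noteq> 0"
          proof
            assume "cos \<theta> = 0"
            then have "cos \<bar>\<theta>\<bar> = cos (pi / 2)" by simp
            then have "\<bar>\<theta>\<bar> = pi / 2" by (rule cos_inj_pi[rotated 4]) (use \<theta> in auto)
            then have "\<theta> = pi / 2 \<or> \<theta> = -(pi / 2)" by linarith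
            then show False using elim by blast
          qed
          then have "0 < (cos \<theta>)\<^sup>2" by simp
          then have "(sin \<theta>)\<^sup>2 < 1" using sin_cos_squared_add[of \<theta>] by linarith
          then have "\<bar>sin \<theta>\<bar> < 1" by (simp add: abs_square_less_1)
          then have "W \<bar>sin \<theta>\<bar> = g \<bar>sin \<theta>\<bar>" using s by (simp add: W_def)
          moreover have "\<bar>cos \<theta>\<bar> = sqrt (1 - \<bar>sin \<theta>\<bar>\<^sup>2)"
            by (simp only: power2_abs cos_squared_eq[symmetric] real_sqrt_abs)
          ultimately have "H \<theta> = g \<bar>sin \<theta>\<bar> * sqrt (1 - \<bar>sin \<theta>\<bar>\<^sup>2)"
            by (simp only: H_def)
          also have "\<dots> = c" by (rule const) (use s \<open>\<bar>sin \<theta>\<bar> < 1\<close> in simp_all)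
          finally show "H \<theta> = c" .
        qed
      qed
    qed
    have H_const: "(\<integral>\<^sup>+\<theta>\<in>{-pi..pi}. ennreal (H \<theta> * f \<theta>) \<partial>lborel) =
        (\<integral>\<^sup>+\<theta>\<in>{-pi..pi}. ennreal (c * f \<theta>) \<partial>lborel)" for f
    proof (rule nn_integral_cong_AE)
      show "AE \<theta> in lborel. ennreal (H \<theta> * f \<theta>) * indicator {-pi..pi} \<theta> =
          ennreal (c * f \<theta>) * indicator {-pi..pi} \<theta>"
        using H_ae by eventually_elim (simp split: split_indicator)
    qed
    show "spherical N U"
      unfolding spherical_def
    proof (intro allI impI)
      fix T :: "real \<times> real \<Rightarrow> real \<times> real" assume T: "orthogonal_transformation T"
      have Tm[measurable]: "T \<in> borel_measurable borel"
        using T by (intro borel_measurable_continuous_onI linear_continuous_on)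
           (simp add: orthogonal_transformation_linear linear_conv_bounded_linear[symmetric])
      show "distr N borel (\<lambda>\<omega>. T (U \<omega>)) = distr N borel U"
      proof (rule measure_eqI)
        fix A assume "A \<in> sets (distr N borel (\<lambda>\<omega>. T (U \<omega>)))"
        then have A[measurable]: "A \<in> sets borel" by simp
        define q where "q v = M.prob {\<omega>\<in>space M. R \<omega> *\<^sub>R v \<in> A}" for v
        have q0: "q v \<ge> 0" for v by (simp add: q_def)
        have qm[measurable]: "q \<in> borel_measurable borel" unfolding q_def by (rule M.scaleR_prob_measurable) simp_all
        have "emeasure (distr N borel (\<lambda>\<omega>. T (U \<omega>))) A = emeasure (distr N borel U) (T -` A)"
          by (simp add: emeasure_distr vimage_comp comp_def measurable_sets_borel[OF Tm])
        also have "\<dots> = ennreal (1/4) * (\<integral>\<^sup>+\<theta>\<in>{-pi..pi}. ennreal (H \<theta> * q (T (sin \<theta>, cos \<theta>))) \<partial>lborel)"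
          by (subst polar) (simp_all add: measurable_sets_borel[OF Tm] q_def orthogonal_transformation_scaleR[OF T] del: scaleR_Pair)
        also have "(\<integral>\<^sup>+\<theta>\<in>{-pi..pi}. ennreal (H \<theta> * q (T (sin \<theta>, cos \<theta>))) \<partial>lborel) =
            (\<integral>\<^sup>+\<theta>\<in>{-pi..pi}. ennreal (c * q (T (sin \<theta>, cos \<theta>))) \<partial>lborel)"
          by (rule H_const)
        also have "\<dots> = (\<integral>\<^sup>+\<theta>\<in>{-pi..pi}. ennreal (c * q (sin \<theta>, cos \<theta>)) \<partial>lborel)"
          by (rule nn_integral_circle_orthogonal[OF _ T, of "\<lambda>v. ennreal (c * q v)"]) simp
        also have "\<dots> = (\<integral>\<^sup>+\<theta>\<in>{-pi..pi}. ennreal (H \<theta> * q (sin \<theta>, cos \<theta>)) \<partial>lborel)"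
          by (rule H_const[symmetric])
        also have "ennreal (1/4) * \<dots> = emeasure (distr N borel U) A"
          by (subst polar) (simp_all add: q_def)
        finally show "emeasure (distr N borel (\<lambda>\<omega>. T (U \<omega>))) A = emeasure (distr N borel U) A" .
      qed simp
    qed
  next
    assume sph: "spherical N U"
    have eq: "P \<rho> u = P1 u" if \<rho>: "0 < \<rho>" "\<rho> < 1" for \<rho> u
    proof -
      define \<sigma> where "\<sigma> = sqrt (1 - \<rho>\<^sup>2)"
      have n: "\<rho>\<^sup>2 + \<sigma>\<^sup>2 = 1" using \<rho> by (simp add: \<sigma>_def power_le_one)
      \<comment> \<open>The reflection of the plane whose first coordinate is \<open>U(\<rho>)\<close>.\<close>
      define T where "T v = (\<rho> * fst v + \<sigma> * snd v, \<sigma> * fst v - \<rho> * snd v)" for v :: "real \<times> real"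
      have "linear T" by (rule linearI) (auto simp: T_def algebra_simps)
      moreover have "T v \<bullet> T w = v \<bullet> w" for v w
      proof -
        have "T v \<bullet> T w = (\<rho>\<^sup>2 + \<sigma>\<^sup>2) * (fst v * fst w + snd v * snd w)"
          by (simp add: T_def inner_prod_def power2_eq_square algebra_simps)
        then show ?thesis by (simp add: n inner_prod_def)
      qed
      ultimately have "orthogonal_transformation T" by (simp add: orthogonal_transformation_def)
      then have eq: "distr N borel (\<lambda>\<omega>. T (U \<omega>)) = distr N borel U" using sph by (simp add: spherical_def)
      have Tm: "T \<in> borel_measurable borel"
        unfolding T_def by (intro borel_measurable_continuous_onI continuous_intros)
      have TU[measurable]: "(\<lambda>\<omega>. T (U \<omega>)) \<in> borel_measurable N" using Tm by measurable
      let ?A = "{v::real\<times>real. fst v > u}"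
      have A: "?A \<in> sets borel"
        using half_plane_borel[of u 1 0] by simp
      have "P \<rho> u = measure (distr N borel (\<lambda>\<omega>. T (U \<omega>))) ?A"
        unfolding P_def by (subst measure_distr[OF TU A]) (auto simp: T_def \<sigma>_def intro!: arg_cong[where f=N.prob])
      also have "\<dots> = P1 u"
        unfolding eq P1_def by (subst measure_distr[OF U_meas A]) (auto intro!: arg_cong[where f=N.prob])
      finally show ?thesis .
    qed
    show "\<forall>\<rho>\<in>{0<..<1}. ((\<lambda>u. P \<rho> u / P1 u) \<longlongrightarrow> 1) (at_left 1)"
    proof
      fix \<rho> :: real assume "\<rho> \<in> {0<..<1}"
      then have "eventually (\<lambda>u. P \<rho> u / P1 u = 1) (at_left 1)"
        using ev0 eq \<rho>\<^sub>0 by (auto elim!: eventually_mono)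
      then show "((\<lambda>u. P \<rho> u / P1 u) \<longlongrightarrow> 1) (at_left 1)" by (rule tendsto_eventually)
    qed
  qed
qed

end
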